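(* For any (nonempty) abstract simplicial complex $K$, $\mathrm{scat}\,K\le \mathrm{TC}(K)$, where $\mathrm{scat}\,K$ is the normalized simplicial LS-category and $\mathrm{TC}(K)$ is the discrete topological complexity of $K$.
   Context: Contiguity: two simplicial maps $\varphi,\psi\colon K\to L$ are contiguous ($\varphi\sim_c\psi$) if for every simplex $\sigma\in K$ the union of vertex sets $\varphi(\sigma)\cup\psi(\sigma)$ is a simplex of $L$. They are in the same contiguity class ($\varphi\sim\psi$) if there is a finite sequence of simplicial maps $\varphi=h_0\sim_c h_1\sim_c\cdots\sim_c h_m=\psi$ from $K$ to $L$. A constant map sends every vertex of its domain to one fixed vertex. Simplicial LS-category: a subcomplex $L\subset K$ is categorical if the inclusion $\iota_L\colon L\to K$ is in the same contiguity class as some constant map $L\to K$. The normalized simplicial LS-category $\mathrm{scat}\,K$ is the minimum $m\ge 0$ such that $K=L_0\cup\cdots\cup L_m$ with each $L_j$ a categorical subcomplex ($\infty$ if there is no such $m$). Categorical product: $K^2=K\,\Pi\,K$ is the simplicial complex with vertex set $V(K)\times V(K)$, in which a finite set $\sigma$ of vertices is a simplex if and only if both projections $\pi_1(\sigma)$ and $\pi_2(\sigma)$ are simplices of $K$. The diagonal $\Delta\colon K\to K^2$ is the simplicial map $\Delta(v)=(v,v)$. A subcomplex $\Omega\subset K^2$, with inclusion $\iota_\Omega\colon\Omega\to K^2$, is a Farber subcomplex if there exists a simplicial map $\sigma\colon\Omega\to K$ such that $\Delta\circ\sigma\sim\iota_\Omega$. The discrete topological complexity $\mathrm{TC}(K)$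 is the least integer $n\ge 0$ such that $K^2=\Omega_0\cup\cdots\cup\Omega_n$ for some Farber subcomplexes $\Omega_0,\dots,\Omega_n$ of $K^2$ ($\infty$ if there is no such $n$). *)

theory Defs
  imports "HOL-Library.Extended_Nat"
begin

text \<open>
  An abstract simplicial complex is given by its set of simplices, which are nonempty; its
  vertices are the elements of simplices. Infinite complexes are allowed, and the empty set of
  simplices is a complex.
\<close>

definition simplicial_complex :: "'a set set \<Rightarrow> bool" where
  "simplicial_complex K \<longleftrightarrow>
     (\<forall>s\<in>K. finite s \<and> s \<noteq> {}) \<and> (\<forall>s\<in>K. \<forall>t. t \<subseteq> s \<and> t \<noteq> {} \<longrightarrow> t \<in> K)"

definition vertices :: "'a set set \<Rightarrow> 'a set" where
  "vertices K = \<Union>K"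

definition subcomplex :: "'a set set \<Rightarrow> 'a set set \<Rightarrow> bool" where
  "subcomplex L K \<longleftrightarrow> simplicial_complex L \<and> L \<subseteq> K"

text \<open>
  A map of complexes is a total function on the vertex type whose values outside the vertices of
  the domain are irrelevant: all notions below depend only on its restriction to the vertices. In
  particular, two simplicial maps that agree on the vertices of the domain are contiguous, and the
  inclusion of a subcomplex is represented by the identity function.
\<close>

definition simplicial_map :: "'a set set \<Rightarrow> 'b set set \<Rightarrow> ('a \<Rightarrow> 'b) \<Rightarrow> bool" where
  "simplicial_map K L f \<longleftrightarrow> (\<forall>s\<in>K. f ` s \<in> L)"

definition contiguous :: "'a set set \<Rightarrow> 'b set set \<Rightarrow> ('a \<Rightarrow> 'b) \<Rightarrow> ('a \<Rightarrow> 'b) \<Rightarrow> bool" where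
  "contiguous K L f g \<longleftrightarrow>
     simplicial_map K L f \<and> simplicial_map K L g \<and> (\<forall>s\<in>K. f ` s \<union> g ` s \<in> L)"

definition same_contiguity_class ::
    "'a set set \<Rightarrow> 'b set set \<Rightarrow> ('a \<Rightarrow> 'b) \<Rightarrow> ('a \<Rightarrow> 'b) \<Rightarrow> bool" where
  "same_contiguity_class K L f g \<longleftrightarrow>
     (\<exists>(m::nat) h. h 0 = f \<and> h m = g \<and>
        (\<forall>i\<le>m. simplicial_map K L (h i)) \<and>
        (\<forall>i<m. contiguous K L (h i) (h (Suc i))))"

definition constant_map :: "'a set set \<Rightarrow> 'b set set \<Rightarrow> ('a \<Rightarrow> 'b) \<Rightarrow> bool" where
  "constant_map K L c \<longleftrightarrow> (\<exists>v\<in>vertices L. \<forall>x\<in>vertices K. c x = v)"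

definition categorical_subcomplex :: "'a set set \<Rightarrow> 'a set set \<Rightarrow> bool" where
  "categorical_subcomplex L K \<longleftrightarrow>
     subcomplex L K \<and> (\<exists>c. constant_map L K c \<and> same_contiguity_class L K (\<lambda>x. x) c)"

text \<open>The infimum of the empty set in \<^typ>\<open>enat\<close> is \<open>\<infinity>\<close>.\<close>

definition scat :: "'a set set \<Rightarrow> enat" where
  "scat K = Inf {enat m | m. \<exists>L :: nat \<Rightarrow> 'a set set.
     (\<forall>j\<le>m. categorical_subcomplex (L j) K) \<and> K = (\<Union>j\<le>m. L j)}"

definition categorical_product :: "'a set set \<Rightarrow> 'b set set \<Rightarrow> ('a \<times> 'b) set set" where
  "categorical_product K L =
     {s. finite s \<and> s \<subseteq> vertices K \<times> vertices L \<and> fst ` s \<in> K \<and> snd ` s \<in> L}"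

definition diagonal :: "'a \<Rightarrow> 'a \<times> 'a" where
  "diagonal v = (v, v)"

definition farber_subcomplex :: "('a \<times> 'a) set set \<Rightarrow> 'a set set \<Rightarrow> bool" where
  "farber_subcomplex W K \<longleftrightarrow>
     subcomplex W (categorical_product K K) \<and>
     (\<exists>s. simplicial_map W K s \<and>
        same_contiguity_class W (categorical_product K K) (diagonal \<circ> s) (\<lambda>x. x))"

definition TC :: "'a set set \<Rightarrow> enat" where
  "TC K = Inf {enat n | n. \<exists>W :: nat \<Rightarrow> ('a \<times> 'a) set set.
     (\<forall>j\<le>n. farber_subcomplex (W j) K) \<and> categorical_product K K = (\<Union>j\<le>n. W j)}"

end

theory Submission
  imports Defs
begin

text \<open>
  Fix a vertex \<open>v\<close> of \<open>K\<close> and embed \<open>K\<close> into \<open>K\<^sup>2\<close> as the slice \<open>x \<mapsto> (v, x)\<close>. Any cover of \<open>K\<^sup>2\<close> by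
  Farber subcomplexes pulls back along this embedding to a cover of \<open>K\<close> by equally many subcomplexes,
  so it is enough that the pullback \<open>L\<close> of a Farber subcomplex \<open>W\<close> is categorical
  (\<open>categorical_slice\<close>).

  Let \<open>s\<close> be a section over \<open>W\<close>, so that \<open>\<Delta> \<circ> s\<close> lies in the contiguity class of the inclusion
  \<open>W \<rightarrow> K\<^sup>2\<close>. Precomposing with the slice embedding gives the relation
  \<open>(s (v, x), s (v, x)) \<sim> (v, x)\<close> between maps \<open>L \<rightarrow> K\<^sup>2\<close>. Its first projection says that
  \<open>x \<mapsto> s (v, x)\<close> is in the class of the constant map at \<open>v\<close>, and its second projection says that the
  same map is in the class of the inclusion of \<open>L\<close>. Hence the inclusion and the constant map are in the
  same class. The argument uses only that contiguity classes are compatible with composition on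
  either side (\<open>same_contiguity_class_compose\<close>), and that they are symmetric and transitive.
\<close>

lemma simplicial_map_compose:
  assumes "simplicial_map J K f" and "simplicial_map K L g"
  shows "simplicial_map J L (g \<circ> f)"
  using assms unfolding simplicial_map_def image_comp [symmetric] by blast

lemma contiguous_sym: "contiguous K L f g \<Longrightarrow> contiguous K L g f"
  by (simp add: contiguous_def Un_commute)

lemma contiguous_compose:
  assumes "simplicial_map J K a" and "contiguous K L f g" and "simplicial_map L M b"
  shows "contiguous J M (b \<circ> f \<circ> a) (b \<circ> g \<circ> a)"
  unfolding contiguous_def
proof (intro conjI ballI)
  show "simplicial_map J M (b \<circ> f \<circ> a)" "simplicial_map J M (b \<circ> g \<circ> a)"
    using assms by (auto simp: contiguous_def intro: simplicial_map_compose)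
next
  fix s assume "s \<in> J"
  then have "b ` (f ` a ` s \<union> g ` a ` s) \<in> M"
    using assms by (simp add: simplicial_map_def contiguous_def)
  then show "(b \<circ> f \<circ> a) ` s \<union> (b \<circ> g \<circ> a) ` s \<in> M"
    by (simp add: image_Un image_comp comp_assoc)
qed

text \<open>
  Passing from explicit chains to the closure of the contiguity relation makes symmetry and
  transitivity available without reversing and concatenating indexed sequences. Simpliciality of \<open>f\<close> has
  to be recorded separately, for the chain of length zero.
\<close>

lemma same_contiguity_class_iff_rtranclp:
  "same_contiguity_class K L f g \<longleftrightarrow> simplicial_map K L f \<and> (contiguous K L)\<^sup>*\<^sup>* f g"
proof
  assume "same_contiguity_class K L f g"
  then show "simplicial_map K L f \<and> (contiguous K L)\<^sup>*\<^sup>* f g"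
    unfolding same_contiguity_class_def rtranclp_power relpowp_fun_conv by (blast intro: zero_le)
next
  assume fg: "simplicial_map K L f \<and> (contiguous K L)\<^sup>*\<^sup>* f g"
  then obtain m h where h: "h 0 = f" "h m = g" "\<forall>i<m. contiguous K L (h i) (h (Suc i))"
    unfolding rtranclp_power relpowp_fun_conv by blast
  have "simplicial_map K L (h i)" if "i \<le> m" for i
    using that fg h by (cases i) (auto simp: contiguous_def)
  with h show "same_contiguity_class K L f g"
    unfolding same_contiguity_class_def by blast
qed

lemma same_contiguity_class_sym:
  assumes "same_contiguity_class K L f g"
  shows "same_contiguity_class K L g f"
proof -
  have "simplicial_map K L g"
    using assms unfolding same_contiguity_class_def by auto
  moreover have "(contiguous K L)\<^sup>*\<^sup>* g f"
  proof -
    have "symp (contiguous K L)"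
      by (rule sympI) (rule contiguous_sym)
    moreover have "(contiguous K L)\<^sup>*\<^sup>* f g"
      using assms by (simp add: same_contiguity_class_iff_rtranclp)
    ultimately show ?thesis
      by (rule sympD [OF symp_rtranclp])
  qed
  ultimately show ?thesis
    by (simp add: same_contiguity_class_iff_rtranclp)
qed

lemma same_contiguity_class_trans:
  assumes "same_contiguity_class K L f g" and "same_contiguity_class K L g h"
  shows "same_contiguity_class K L f h"
  using assms by (auto simp: same_contiguity_class_iff_rtranclp)

lemma same_contiguity_class_compose:
  assumes "simplicial_map J K a" and "same_contiguity_class K L f g" and "simplicial_map L M b"
  shows "same_contiguity_class J M (b \<circ> f \<circ> a) (b \<circ> g \<circ> a)"
proof -
  have "(contiguous K L)\<^sup>*\<^sup>* f g"
    using assms by (simp add: same_contiguity_class_iff_rtranclp)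
  then have "(contiguous J M)\<^sup>*\<^sup>* (b \<circ> f \<circ> a) (b \<circ> g \<circ> a)"
  proof induction
    case (step g h)
    have "contiguous J M (b \<circ> g \<circ> a) (b \<circ> h \<circ> a)"
      by (rule contiguous_compose [OF assms(1) step.hyps(2) assms(3)])
    with step.IH show ?case
      by (metis rtranclp.rtrancl_into_rtrancl)
  qed simp
  then show ?thesis
    using assms by (auto simp: same_contiguity_class_iff_rtranclp intro: simplicial_map_compose)
qed

lemma simplicial_map_fst: "simplicial_map (categorical_product K L) K fst"
  by (simp add: simplicial_map_def categorical_product_def)

lemma simplicial_map_snd: "simplicial_map (categorical_product K L) L snd"
  by (simp add: simplicial_map_def categorical_product_def)

lemma simplicial_map_slice:
  assumes "simplicial_complex L" and "simplicial_complex K" and "v \<in> vertices K"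
  shows "simplicial_map L (categorical_product K L) (Pair v)"
  unfolding simplicial_map_def
proof
  fix s assume s: "s \<in> L"
  then have "finite s" "s \<noteq> {}"
    using assms(1) by (auto simp: simplicial_complex_def)
  moreover have "{v} \<in> K"
  proof -
    obtain t where t: "t \<in> K" "{v} \<subseteq> t"
      using assms(3) by (auto simp: vertices_def)
    have "{v} \<noteq> {}" by simp
    with t assms(2) show ?thesis
      unfolding simplicial_complex_def by blast
  qed
  ultimately show "Pair v ` s \<in> categorical_product K L"
    using s assms(3) by (auto simp: categorical_product_def vertices_def image_comp image_constant_conv)
qed

lemma subcomplex_preimage:
  assumes "simplicial_complex K" and "simplicial_complex W"
  shows "subcomplex {t \<in> K. f ` t \<in> W} K"
  unfolding subcomplex_def simplicial_complex_def
proof (intro conjI ballI allI impI)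
  show "finite t" "t \<noteq> {}" if "t \<in> {t \<in> K. f ` t \<in> W}" for t
    using that assms(1) by (auto simp: simplicial_complex_def)
  show "u \<in> {t \<in> K. f ` t \<in> W}"
    if t: "t \<in> {t \<in> K. f ` t \<in> W}" and u: "u \<subseteq> t \<and> u \<noteq> {}" for t u
  proof -
    have "u \<in> K"
      using t u assms(1) unfolding simplicial_complex_def by blast
    moreover have "f ` u \<subseteq> f ` t" "f ` u \<noteq> {}"
      using u by auto
    then have "f ` u \<in> W"
      using t assms(2) unfolding simplicial_complex_def by blast
    ultimately show ?thesis by simp
  qed
qed auto

text \<open>
  The two projections of the chain from \<open>\<Delta> \<circ> s\<close> to the inclusion of \<open>W\<close> link both the constant map at
  \<open>v\<close> and the inclusion to the same map \<open>x \<mapsto> s (v, x)\<close>.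
\<close>

lemma categorical_slice:
  assumes K: "simplicial_complex K" and v: "v \<in> vertices K" and W: "farber_subcomplex W K"
  shows "categorical_subcomplex {t \<in> K. Pair v ` t \<in> W} K" (is "categorical_subcomplex ?L K")
proof -
  obtain s where
    s: "same_contiguity_class W (categorical_product K K) (diagonal \<circ> s) (\<lambda>x. x)"
    using W by (auto simp: farber_subcomplex_def)
  have slice: "simplicial_map ?L W (Pair v)"
    by (simp add: simplicial_map_def)
  have "same_contiguity_class ?L K (fst \<circ> (diagonal \<circ> s) \<circ> Pair v) (fst \<circ> (\<lambda>x. x) \<circ> Pair v)"
    by (rule same_contiguity_class_compose [OF slice s simplicial_map_fst])
  then have const: "same_contiguity_class ?L K (\<lambda>x. s (v, x)) (\<lambda>x. v)"
    by (simp add: comp_def diagonal_def)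
  have "same_contiguity_class ?L K (snd \<circ> (diagonal \<circ> s) \<circ> Pair v) (snd \<circ> (\<lambda>x. x) \<circ> Pair v)"
    by (rule same_contiguity_class_compose [OF slice s simplicial_map_snd])
  then have "same_contiguity_class ?L K (\<lambda>x. s (v, x)) (\<lambda>x. x)"
    by (simp add: comp_def diagonal_def)
  then have "same_contiguity_class ?L K (\<lambda>x. x) (\<lambda>x. v)"
    using const by (blast intro: same_contiguity_class_sym same_contiguity_class_trans)
  moreover have "subcomplex ?L K"
    using K W by (intro subcomplex_preimage) (auto simp: farber_subcomplex_def subcomplex_def)
  moreover have "constant_map ?L K (\<lambda>x. v)"
    using v by (auto simp: constant_map_def)
  ultimately show ?thesis
    unfolding categorical_subcomplex_def by blast
qed

theorem theorem4p2:
  fixes K :: "'a set set"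
  assumes "simplicial_complex K" and "K \<noteq> {}"
  shows "scat K \<le> TC K"
proof -
  obtain v where v: "v \<in> vertices K"
  proof -
    obtain t where "t \<in> K" using assms(2) by blast
    moreover from this have "t \<noteq> {}" using assms(1) by (simp add: simplicial_complex_def)
    ultimately show ?thesis using that by (auto simp: vertices_def)
  qed
  have "\<exists>L :: nat \<Rightarrow> 'a set set.
      (\<forall>j\<le>n. categorical_subcomplex (L j) K) \<and> K = (\<Union>j\<le>n. L j)"
    if W: "\<forall>j\<le>n. farber_subcomplex (W j) K" "categorical_product K K = (\<Union>j\<le>n. W j)"
    for n and W :: "nat \<Rightarrow> ('a \<times> 'a) set set"
  proof (intro exI conjI)
    show "\<forall>j\<le>n. categorical_subcomplex {t \<in> K. Pair v ` t \<in> W j} K"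
      using assms(1) v W(1) by (blast intro: categorical_slice)
    have "simplicial_map K (\<Union>j\<le>n. W j) (Pair v)"
      using simplicial_map_slice [OF assms(1) assms(1) v] W(2) by simp
    then show "K = (\<Union>j\<le>n. {t \<in> K. Pair v ` t \<in> W j})"
      by (auto simp: simplicial_map_def)
  qed
  then have "{enat n | n. \<exists>W :: nat \<Rightarrow> ('a \<times> 'a) set set.
        (\<forall>j\<le>n. farber_subcomplex (W j) K) \<and> categorical_product K K = (\<Union>j\<le>n. W j)}
      \<subseteq> {enat n | n. \<exists>L :: nat \<Rightarrow> 'a set set.
        (\<forall>j\<le>n. categorical_subcomplex (L j) K) \<and> K = (\<Union>j\<le>n. L j)}"
    by (smt (verit) Collect_mono)
  then show ?thesis
    unfolding scat_def TC_def by (rule Inf_superset_mono)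
qed

end
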